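(* Let $P$ be a set of $n$ points in the tropical plane $\mathbb{R}^2$. The number of stable tropical lines determined by $P$ is equal to the number of stable intersections obtained in the corresponding dual tropical line arrangement.
   Context: The tropical line with vertex $p\in\mathbb{R}^2$ is the union of the three closed rays emanating from $p$ in the directions $(-1,0)$, $(0,-1)$, $(1,1)$ (max convention). Stable tropical lines. Let $L$ be a tropical line and $p_1,\dots,p_k$ ($k\ge 2$) points on $L$. Then $(L,p_1,\dots,p_k)$ is called stable if either $L$ is the unique tropical line passing through all of $p_1,\dots,p_k$, or one of $p_1,\dots,p_k$ is the vertex of $L$. A stable tropical line determined by a finite set $P$ is a tropical line $L$ containing at least two points of $P$ such that $L$ together with the points of $P$ on it is stable; these are counted as distinct lines $L$. Dual arrangement. The tropical line arrangement dual to $P$ consists of the tropical lines with vertices $-p$, for $p\in P$. Stable intersections. Two distinct tropical lines $L,L'$ have a unique stable intersection point, namely the limit, as $\epsilon\to 0$, of the intersection points of nearby tropical lines (translates of $L$ and $L'$ within $\epsilon$) that meet in a unique point. The stable intersections of a tropical line arrangement are the points of $\mathbb{R}^2$ that are the stable intersection of some two distinct lines of the arrangement; they are counted as distinct points. *)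

theory Defs
  imports "HOL-Analysis.Analysis"
begin

definition tropical_line :: "real \<times> real \<Rightarrow> (real \<times> real) set" where
  "tropical_line p =
     {p + t *\<^sub>R (-1, 0) | t. 0 \<le> t} \<union> {p + t *\<^sub>R (0, -1) | t. 0 \<le> t} \<union> {p + t *\<^sub>R (1, 1) | t. 0 \<le> t}"

definition is_tropical_line :: "(real \<times> real) set \<Rightarrow> bool" where
  "is_tropical_line L \<longleftrightarrow> (\<exists>p. L = tropical_line p)"

definition is_vertex :: "real \<times> real \<Rightarrow> (real \<times> real) set \<Rightarrow> bool" where
  "is_vertex p L \<longleftrightarrow> L = tropical_line p"

definition stable_tropical_line :: "(real \<times> real) set \<Rightarrow> (real \<times> real) set \<Rightarrow> bool" where
  "stable_tropical_line L Q \<longleftrightarrow>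
     is_tropical_line L \<and> finite Q \<and> card Q \<ge> 2 \<and> Q \<subseteq> L \<and>
     ((\<forall>L'. is_tropical_line L' \<and> Q \<subseteq> L' \<longrightarrow> L' = L) \<or> (\<exists>p\<in>Q. is_vertex p L))"

definition stable_lines_determined_by :: "(real \<times> real) set \<Rightarrow> (real \<times> real) set set" where
  "stable_lines_determined_by P = {L. stable_tropical_line L (P \<inter> L)}"

definition dual_arrangement :: "(real \<times> real) set \<Rightarrow> (real \<times> real) set set" where
  "dual_arrangement P = (\<lambda>p. tropical_line (- p)) ` P"

text \<open>A pair \<open>(u, v)\<close> of translation vectors stands for the pair of translates of two lines by
  \<open>u\<close> and \<open>v\<close>; the stable intersection is the limit as \<open>(u, v)\<close> tends to \<open>0\<close> through those pairs
  for which the translates meet in exactly one point. For distinct tropical lines such pairs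
  accumulate at \<open>0\<close> and the limit exists, so \<^const>\<open>Lim\<close> denotes it.\<close>

definition translates_meet :: "(real \<times> real) set \<Rightarrow> (real \<times> real) set
    \<Rightarrow> (real \<times> real) \<times> (real \<times> real) \<Rightarrow> (real \<times> real) set" where
  "translates_meet L L' w = (+) (fst w) ` L \<inter> (+) (snd w) ` L'"

definition stable_intersection :: "(real \<times> real) set \<Rightarrow> (real \<times> real) set \<Rightarrow> real \<times> real" where
  "stable_intersection L L' =
     Lim (at 0 within {w. is_singleton (translates_meet L L' w)})
       (\<lambda>w. the_elem (translates_meet L L' w))"

definition stable_intersections :: "(real \<times> real) set set \<Rightarrow> (real \<times> real) set" where
  "stable_intersections A = {stable_intersection L L' | L L'. L \<in> A \<and> L' \<in> A \<and> L \<noteq> L'}"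

end

theory Submission imports Defs begin

text \<open>
  A point and a line can be exchanged: \<open>p\<close> lies on the line with vertex \<open>v\<close> iff \<open>-v\<close> lies on the
  line with vertex \<open>-p\<close> (\<open>incidence_duality\<close>). So a line through \<open>p\<close> and \<open>q\<close> is the same thing as a
  common point of their dual lines, and the theorem says more precisely that
  \<open>x \<mapsto> tropical_line (-x)\<close> maps the stable intersections of the dual arrangement bijectively onto
  the stable lines. It is injective because a line determines its vertex.

  The limit that defines a stable intersection is computed once and for all by an explicit formula,
  tropical Cramer's rule (\<open>tropical_cross\<close>). Its value depends continuously on the two vertices and
  always lies on both lines, so it is the intersection point whenever there is only one, and
  by continuity it is the limit at the given pair of lines
  (\<open>stable_intersection_tropical_lines\<close>).

  Two lines, neither of which contains the vertex of the other, meet in exactly one point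
  (\<open>generic_intersection\<close>). If instead the vertex of one lies on the other, that vertex is their
  stable intersection (\<open>tropical_cross_eq_vertex\<close>). Under duality these two cases are the two ways
  in which a line can be stable. A generic pair \<open>-p\<close>, \<open>-q\<close> gives the only line through \<open>p\<close> and
  \<open>q\<close>; a degenerate pair gives a line with vertex \<open>p\<close> or \<open>q\<close> (\<open>stable_line_of_cross\<close>).
  Conversely (\<open>cross_of_stable_line\<close>), if the vertex of a stable line is one of the points, it pairs
  with any other point on the line. If the line is the only one through its points and its vertex
  is not among them, then the points cannot all lie on one of its rays, since otherwise the vertex
  could be slid along that ray up to the first of them (\<open>slide_vertex\<close>); two points on different
  rays form a generic pair.
\<close>

section \<open>Incidence of points and tropical lines\<close>

lemma mem_tropical_line_iff:
  "x \<in> tropical_line p \<longleftrightarrow>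
     fst x \<le> fst p \<and> snd x = snd p \<or> fst x = fst p \<and> snd x \<le> snd p \<or>
     fst p \<le> fst x \<and> fst x - fst p = snd x - snd p"
proof -
  have "(\<exists>t. x = p + t *\<^sub>R (-1, 0) \<and> 0 \<le> t) \<longleftrightarrow> fst x \<le> fst p \<and> snd x = snd p"
    by (auto simp: prod_eq_iff intro!: exI[of _ "fst p - fst x"])
  moreover have "(\<exists>t. x = p + t *\<^sub>R (0, -1) \<and> 0 \<le> t) \<longleftrightarrow> fst x = fst p \<and> snd x \<le> snd p"
    by (auto simp: prod_eq_iff intro!: exI[of _ "snd p - snd x"])
  moreover have "(\<exists>t. x = p + t *\<^sub>R (1, 1) \<and> 0 \<le> t) \<longleftrightarrow>
      fst p \<le> fst x \<and> fst x - fst p = snd x - snd p"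
    by (auto simp: prod_eq_iff intro!: exI[of _ "fst x - fst p"])
  ultimately show ?thesis
    unfolding tropical_line_def by blast
qed

lemma vertex_in_tropical_line: "p \<in> tropical_line p"
  by (simp add: mem_tropical_line_iff)

text \<open>If each vertex lies on the other line, then \<open>p - q\<close> and \<open>q - p\<close> are both nonnegative
  multiples of ray directions. Distinct ray directions are linearly independent, so
  \<open>p - q = 0\<close>.\<close>
lemma tropical_line_eq_iff [simp]: "tropical_line p = tropical_line q \<longleftrightarrow> p = q"
proof
  assume "tropical_line p = tropical_line q"
  then have "p \<in> tropical_line q" "q \<in> tropical_line p"
    using vertex_in_tropical_line by blast+
  then show "p = q"
    unfolding mem_tropical_line_iff prod_eq_iff by argo
qed simp

lemma tropical_line_translate: "(+) u ` tropical_line p = tropical_line (u + p)"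
proof -
  have "x \<in> (+) u ` tropical_line p \<longleftrightarrow> x - u \<in> tropical_line p" for x
    by (auto simp: image_iff intro!: bexI[of _ "x - u"])
  then show ?thesis
    by (auto simp: mem_tropical_line_iff algebra_simps)
qed

text \<open>Both sides depend on the difference \<open>p - q\<close> only.\<close>
lemma incidence_duality: "p \<in> tropical_line q \<longleftrightarrow> - q \<in> tropical_line (- p)"
  by (auto simp: mem_tropical_line_iff)

section \<open>Tropical Cramer's rule\<close>

text \<open>The line with vertex \<open>p\<close> is where the maximum of \<open>x - fst p\<close>, \<open>y - snd p\<close>, \<open>0\<close> is attained at
  least twice. The max-plus cross product of the coefficient vectors \<open>(- fst p, - snd p, 0)\<close> and
  \<open>(- fst q, - snd q, 0)\<close> is a solution of both conditions in homogeneous coordinates;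
  subtracting its third coordinate from the other two gives the point below.\<close>

definition tropical_cross :: "real \<times> real \<Rightarrow> real \<times> real \<Rightarrow> real \<times> real" where
  "tropical_cross p q =
     (max (- snd p) (- snd q) - max (- fst p - snd q) (- snd p - fst q),
      max (- fst p) (- fst q) - max (- fst p - snd q) (- snd p - fst q))"

lemma tropical_cross_commute: "tropical_cross p q = tropical_cross q p"
  unfolding tropical_cross_def by (auto simp: max_def)

lemma tropical_cross_in_line: "tropical_cross p q \<in> tropical_line p"
  unfolding tropical_cross_def mem_tropical_line_iff by (simp add: max_def)

lemma tropical_cross_in_both:
  "tropical_cross p q \<in> tropical_line p \<inter> tropical_line q"
  using tropical_cross_in_line[of p q] tropical_cross_in_line[of q p]
  by (simp add: tropical_cross_commute)

text \<open>If \<open>p \<noteq> q\<close>, the two lines share a whole ray with endpoint \<open>p\<close>; the formula picks this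
  endpoint.\<close>
lemma tropical_cross_eq_vertex:
  assumes "p \<in> tropical_line q"
  shows "tropical_cross p q = p"
  using assms unfolding tropical_cross_def mem_tropical_line_iff prod_eq_iff
  by (auto simp: max_def)

text \<open>Parallel rays of the two lines are not collinear here, so two common points would have to
  come from two different pairs of non-parallel rays; comparing the coordinates excludes this.\<close>
lemma generic_intersection_unique:
  assumes "p \<notin> tropical_line q" "q \<notin> tropical_line p"
    and "x \<in> tropical_line p" "x \<in> tropical_line q"
    and "y \<in> tropical_line p" "y \<in> tropical_line q"
  shows "x = y"
  using assms unfolding mem_tropical_line_iff prod_eq_iff by argo

lemma generic_intersection:
  assumes "p \<notin> tropical_line q" "q \<notin> tropical_line p"
  shows "tropical_line p \<inter> tropical_line q = {tropical_cross p q}"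
  using generic_intersection_unique[OF assms] tropical_cross_in_both[of p q] by blast

section \<open>Stable intersections as values of the cross product\<close>

lemma tendsto_tropical_cross:
  assumes "(f \<longlongrightarrow> p) F" "(g \<longlongrightarrow> q) F"
  shows "((\<lambda>w. tropical_cross (f w) (g w)) \<longlongrightarrow> tropical_cross p q) F"
  unfolding tropical_cross_def by (intro tendsto_intros assms)

lemma translates_meet_tropical_lines:
  "translates_meet (tropical_line p) (tropical_line q) w =
     tropical_line (fst w + p) \<inter> tropical_line (snd w + q)"
  by (simp add: translates_meet_def tropical_line_translate)

text \<open>Without this the filter would be trivial, every value would be a limit, and \<^const>\<open>Lim\<close>
  would not be determined.\<close>
lemma unique_meets_accumulate:
  "at 0 within {w. is_singleton (translates_meet (tropical_line p) (tropical_line q) w)} \<noteq> bot"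
proof -
  \<comment> \<open>The direction \<open>(1, -1)\<close> is parallel to none of the rays, so translating \<open>p\<close> along
    it brings \<open>q - p\<close> onto the axis of a given ray direction for one parameter only. The three
    exceptional parameters form the set \<open>T\<close>.\<close>
  define w :: "nat \<Rightarrow> (real \<times> real) \<times> (real \<times> real)"
    where "w n = ((inverse (Suc n), - inverse (Suc n)), 0)" for n
  define d where "d = q - p"
  define T where "T = {fst d, - snd d, (fst d - snd d) / 2}"
  have lim: "(\<lambda>n. inverse (real (Suc n))) \<longlonglongrightarrow> 0"
    by (rule LIMSEQ_inverse_real_of_nat)
  have "w \<longlonglongrightarrow> ((0, - 0), 0)"
    unfolding w_def by (intro tendsto_intros lim)
  then have w0: "w \<longlonglongrightarrow> 0"
    by (simp add: zero_prod_def)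
  have "\<forall>\<^sub>F n in sequentially. inverse (real (Suc n)) \<noteq> t" for t
  proof (cases "t = 0")
    case False
    then show ?thesis using tendsto_imp_eventually_ne[OF lim, of t] by simp
  qed simp
  then have "\<forall>\<^sub>F n in sequentially. \<forall>t\<in>T. inverse (real (Suc n)) \<noteq> t"
    by (intro eventually_ball_finite) (auto simp: T_def)
  then have "\<forall>\<^sub>F n in sequentially.
      w n \<in> {w. is_singleton (translates_meet (tropical_line p) (tropical_line q) w)}"
  proof eventually_elim
    case (elim n)
    let ?s = "inverse (real (Suc n))"
    have "?s \<noteq> fst q - fst p" "?s \<noteq> snd p - snd q" "2 * ?s \<noteq> (fst q - fst p) - (snd q - snd p)"
      using elim by (auto simp: T_def d_def)
    then have "fst (w n) + p \<notin> tropical_line (snd (w n) + q)"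
      "snd (w n) + q \<notin> tropical_line (fst (w n) + p)"
      unfolding w_def mem_tropical_line_iff by auto
    then show ?case
      by (simp add: translates_meet_tropical_lines generic_intersection)
  qed
  moreover have "\<forall>\<^sub>F n in sequentially. w n \<noteq> 0"
    by (simp add: w_def zero_prod_def)
  ultimately have "filterlim w
      (at 0 within {w. is_singleton (translates_meet (tropical_line p) (tropical_line q) w)})
      sequentially"
    using w0 by (simp add: filterlim_at eventually_conj_iff)
  then show ?thesis
    unfolding filterlim_def using le_bot filtermap_bot_iff sequentially_bot by metis
qed

text \<open>Wherever the translates meet in one point, that point is the value of the cross product, since
  the latter is always a common point. The function whose limit is taken thus agrees
  with a continuous one.\<close>
lemma stable_intersection_tropical_lines:
  "stable_intersection (tropical_line p) (tropical_line q) = tropical_cross p q"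
proof -
  let ?S = "{w. is_singleton (translates_meet (tropical_line p) (tropical_line q) w)}"
  let ?c = "\<lambda>w. tropical_cross (fst w + p) (snd w + q)"
  have "the_elem (translates_meet (tropical_line p) (tropical_line q) w) = ?c w" if "w \<in> ?S" for w
  proof -
    obtain x where x: "translates_meet (tropical_line p) (tropical_line q) w = {x}"
      using \<open>w \<in> ?S\<close> unfolding is_singleton_def by blast
    then have "?c w = x"
      using tropical_cross_in_both[of "fst w + p" "snd w + q"]
      unfolding translates_meet_tropical_lines by blast
    then show ?thesis
      using x by simp
  qed
  then have ev: "\<forall>\<^sub>F w in at 0 within ?S.
      ?c w = the_elem (translates_meet (tropical_line p) (tropical_line q) w)"
    by (simp add: eventually_at_filter)
  let ?o = "0 :: (real \<times> real) \<times> (real \<times> real)"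
  have "(?c \<longlongrightarrow> tropical_cross (fst ?o + p) (snd ?o + q)) (at 0 within ?S)"
    by (intro tendsto_tropical_cross tendsto_add tendsto_const
        tendsto_fst[OF tendsto_ident_at] tendsto_snd[OF tendsto_ident_at])
  then have "(?c \<longlongrightarrow> tropical_cross p q) (at 0 within ?S)"
    by simp
  then have "((\<lambda>w. the_elem (translates_meet (tropical_line p) (tropical_line q) w))
      \<longlongrightarrow> tropical_cross p q) (at 0 within ?S)"
    using ev by (rule Lim_transform_eventually)
  then show ?thesis
    unfolding stable_intersection_def
    using tendsto_Lim unique_meets_accumulate by blast
qed

lemma stable_intersections_dual_arrangement:
  "stable_intersections (dual_arrangement P) =
     {tropical_cross (- p) (- q) | p q. p \<in> P \<and> q \<in> P \<and> p \<noteq> q}"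
proof (intro equalityI subsetI)
  fix x assume "x \<in> stable_intersections (dual_arrangement P)"
  then obtain p q where "p \<in> P" "q \<in> P" "tropical_line (- p) \<noteq> tropical_line (- q)"
    and "x = stable_intersection (tropical_line (- p)) (tropical_line (- q))"
    unfolding stable_intersections_def dual_arrangement_def by blast
  then show "x \<in> {tropical_cross (- p) (- q) | p q. p \<in> P \<and> q \<in> P \<and> p \<noteq> q}"
    unfolding stable_intersection_tropical_lines by blast
next
  fix x assume "x \<in> {tropical_cross (- p) (- q) | p q. p \<in> P \<and> q \<in> P \<and> p \<noteq> q}"
  then obtain p q where pq: "p \<in> P" "q \<in> P" "p \<noteq> q"
    and x: "x = stable_intersection (tropical_line (- p)) (tropical_line (- q))"
    unfolding stable_intersection_tropical_lines by blast
  have "tropical_line (- p) \<noteq> tropical_line (- q)"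
    using pq(3) by simp
  then show "x \<in> stable_intersections (dual_arrangement P)"
    unfolding x stable_intersections_def dual_arrangement_def using pq(1,2) by blast
qed

section \<open>From stable intersections to stable lines\<close>

lemma stable_line_of_cross:
  assumes "finite P" "p \<in> P" "q \<in> P" "p \<noteq> q"
  shows "tropical_line (- tropical_cross (- p) (- q)) \<in> stable_lines_determined_by P"
proof -
  let ?v = "- tropical_cross (- p) (- q)"
  let ?Q = "P \<inter> tropical_line ?v"
  have pq: "p \<in> ?Q" "q \<in> ?Q"
    using assms tropical_cross_in_both[of "- p" "- q"]
    by (auto simp: incidence_duality[of p] incidence_duality[of q])
  have "card {p, q} \<le> card ?Q"
    using pq assms by (intro card_mono) auto
  then have card: "card ?Q \<ge> 2"
    using assms by simp
  have "(\<forall>L'. is_tropical_line L' \<and> ?Q \<subseteq> L' \<longrightarrow> L' = tropical_line ?v)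
      \<or> (\<exists>r\<in>?Q. is_vertex r (tropical_line ?v))"
  proof (cases "- p \<in> tropical_line (- q) \<or> - q \<in> tropical_line (- p)")
    case True
    then have "?v = p \<or> ?v = q"
      by (metis tropical_cross_eq_vertex tropical_cross_commute minus_minus)
    then have "is_vertex p (tropical_line ?v) \<or> is_vertex q (tropical_line ?v)"
      by (auto simp only: is_vertex_def)
    then show ?thesis
      using pq by blast
  next
    case False
    \<comment> \<open>Dually, \<open>-u\<close> is a common point of the lines of \<open>-p\<close> and \<open>-q\<close>, which have only one.\<close>
    have "u = ?v" if "?Q \<subseteq> tropical_line u" for u
    proof -
      have "- u \<in> tropical_line (- p) \<inter> tropical_line (- q)"
        using that pq by (auto simp: incidence_duality[of _ u])
      then have "- u = tropical_cross (- p) (- q)"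
        using generic_intersection[of "- p" "- q"] False by blast
      then show ?thesis by (metis minus_minus)
    qed
    then show ?thesis
      by (metis is_tropical_line_def)
  qed
  moreover have "is_tropical_line (tropical_line ?v)"
    unfolding is_tropical_line_def by (rule exI, rule refl)
  ultimately show ?thesis
    using card assms(1)
    by (simp only: stable_lines_determined_by_def stable_tropical_line_def mem_Collect_eq
        finite_Int Int_lower2 simp_thms)
qed

section \<open>From stable lines to stable intersections\<close>

definition ray_directions :: "(real \<times> real) set" where
  "ray_directions = {(-1, 0), (0, -1), (1, 1)}"

lemma on_tropical_line_iff_on_ray:
  "x \<in> tropical_line v \<longleftrightarrow> (\<exists>e\<in>ray_directions. \<exists>t\<ge>0. x = v + t *\<^sub>R e)"
  unfolding tropical_line_def ray_directions_def by blast

lemma off_vertex_imp_on_open_ray: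
  assumes "x \<in> tropical_line v" "x \<noteq> v"
  shows "\<exists>e\<in>ray_directions. \<exists>t>0. x = v + t *\<^sub>R e"
proof -
  obtain e t where e: "e \<in> ray_directions" "t \<ge> 0" "x = v + t *\<^sub>R e"
    using assms(1) unfolding on_tropical_line_iff_on_ray by blast
  have "t \<noteq> 0"
    using e(3) assms(2) by auto
  then have "t > 0"
    using e(2) by simp
  then show ?thesis
    using e by blast
qed

text \<open>The difference \<open>s *\<^sub>R e - t *\<^sub>R e'\<close> is a multiple of none of the three directions, because any
  two of them are linearly independent and the third is minus their sum, while the coefficients
  \<open>s\<close> and \<open>-t\<close> have opposite signs.\<close>
lemma different_rays_imp_generic:
  assumes "e \<in> ray_directions" "e' \<in> ray_directions" "e \<noteq> e'" "0 < s" "0 < t"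
  shows "v + s *\<^sub>R e \<notin> tropical_line (v + t *\<^sub>R e')"
  using assms unfolding ray_directions_def mem_tropical_line_iff by auto

text \<open>The new vertex is the point of \<open>Q\<close> nearest to \<open>v\<close>; the ray from it still contains all the
  others.\<close>
lemma slide_vertex:
  assumes "finite Q" "Q \<noteq> {}" "e \<in> ray_directions"
    and "\<And>x. x \<in> Q \<Longrightarrow> \<exists>t>0. x = v + t *\<^sub>R e"
  shows "\<exists>u. u \<noteq> v \<and> Q \<subseteq> tropical_line u"
proof -
  obtain \<tau> where \<tau>: "\<And>x. x \<in> Q \<Longrightarrow> 0 < \<tau> x \<and> x = v + \<tau> x *\<^sub>R e"
    using assms(4) by metis
  define m where "m = Min (\<tau> ` Q)"
  have m: "m > 0" "\<And>x. x \<in> Q \<Longrightarrow> m \<le> \<tau> x"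
    using assms(1,2) \<tau> by (auto simp: m_def)
  have "x \<in> tropical_line (v + m *\<^sub>R e)" if "x \<in> Q" for x
  proof -
    have "x = (v + m *\<^sub>R e) + (\<tau> x - m) *\<^sub>R e"
      using \<tau>[OF that] by (simp add: scaleR_left_diff_distrib)
    moreover have "\<tau> x - m \<ge> 0"
      using m(2)[OF that] by simp
    ultimately show ?thesis
      using assms(3) unfolding on_tropical_line_iff_on_ray by blast
  qed
  moreover have "e \<noteq> 0"
    using assms(3) by (auto simp: ray_directions_def zero_prod_def)
  ultimately show ?thesis
    using m(1) by (intro exI[of _ "v + m *\<^sub>R e"]) auto
qed

text \<open>Points on a single open ray do not determine the line, by sliding. Hence two
  of the points lie on different rays.\<close>
lemma unique_line_imp_two_rays:
  assumes "finite Q" "Q \<noteq> {}" "Q \<subseteq> tropical_line v" "v \<notin> Q"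
    and unique: "\<And>u. Q \<subseteq> tropical_line u \<Longrightarrow> u = v"
  shows "\<exists>p\<in>Q. \<exists>q\<in>Q. p \<notin> tropical_line q \<and> q \<notin> tropical_line p"
proof -
  have on_ray: "\<exists>e\<in>ray_directions. \<exists>t>0. x = v + t *\<^sub>R e" if "x \<in> Q" for x
    using that assms(3,4) by (intro off_vertex_imp_on_open_ray) auto
  obtain p where p: "p \<in> Q"
    using assms(2) by blast
  obtain e s where e: "e \<in> ray_directions" "s > 0" "p = v + s *\<^sub>R e"
    using on_ray[OF p] by blast
  have "\<not> (\<forall>x\<in>Q. \<exists>t>0. x = v + t *\<^sub>R e)"
    using slide_vertex[OF assms(1,2) e(1)] unique by metis
  then obtain q where q: "q \<in> Q" "\<not> (\<exists>t>0. q = v + t *\<^sub>R e)"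
    by blast
  obtain e' t where e': "e' \<in> ray_directions" "t > 0" "q = v + t *\<^sub>R e'"
    using on_ray[OF q(1)] by blast
  have "e \<noteq> e'"
    using q(2) e' by blast
  then have "p \<notin> tropical_line q" "q \<notin> tropical_line p"
    using e e' different_rays_imp_generic by metis+
  then show ?thesis
    using p q(1) by blast
qed

text \<open>A vertex that is itself one of the points pairs with any second point on the line; otherwise
  two points on different rays have dual lines meeting only in \<open>- v\<close>.\<close>
lemma cross_of_stable_line:
  assumes "tropical_line v \<in> stable_lines_determined_by P"
  shows "\<exists>p\<in>P. \<exists>q\<in>P. p \<noteq> q \<and> v = - tropical_cross (- p) (- q)"
proof -
  let ?Q = "P \<inter> tropical_line v"
  have "stable_tropical_line (tropical_line v) ?Q"
    using assms by (simp add: stable_lines_determined_by_def)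
  then have fin: "finite ?Q" and card: "card ?Q \<ge> 2"
    and unique_or_vertex: "(\<forall>L'. is_tropical_line L' \<and> ?Q \<subseteq> L' \<longrightarrow> L' = tropical_line v) \<or>
      (\<exists>p\<in>?Q. is_vertex p (tropical_line v))"
    by (simp_all only: stable_tropical_line_def)
  show ?thesis
  proof (cases "v \<in> ?Q")
    case True
    have "\<not> ?Q \<subseteq> {v}"
      using card card_mono[of "{v}" ?Q] by auto
    then obtain q where q: "q \<in> ?Q" "q \<noteq> v"
      by blast
    then have "- v \<in> tropical_line (- q)"
      using incidence_duality[of q v] by blast
    then have "v = - tropical_cross (- v) (- q)"
      by (simp only: tropical_cross_eq_vertex minus_minus)
    moreover have "v \<in> P" "q \<in> P" "v \<noteq> q"
      using True q by auto
    ultimately show ?thesis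
      by (intro bexI[of _ v] bexI[of _ q] conjI)
  next
    case False
    then have "\<not> (\<exists>p\<in>?Q. is_vertex p (tropical_line v))"
      by (metis is_vertex_def tropical_line_eq_iff)
    then have "u = v" if "?Q \<subseteq> tropical_line u" for u
      using unique_or_vertex that is_tropical_line_def tropical_line_eq_iff by metis
    moreover have "?Q \<noteq> {}"
      using card by auto
    ultimately obtain p q where pq: "p \<in> ?Q" "q \<in> ?Q"
      and generic: "p \<notin> tropical_line q" "q \<notin> tropical_line p"
      using unique_line_imp_two_rays[OF fin, of v] False by blast
    have "- v \<in> tropical_line (- p) \<inter> tropical_line (- q)"
      using pq by (simp add: incidence_duality[of _ v])
    also have "\<dots> = {tropical_cross (- p) (- q)}"
      using generic by (intro generic_intersection) (simp_all add: incidence_duality[symmetric])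
    finally have "v = - tropical_cross (- p) (- q)"
      by (metis minus_minus singletonD)
    moreover have "p \<noteq> q"
      using generic vertex_in_tropical_line by blast
    ultimately show ?thesis
      using pq by blast
  qed
qed

theorem proposition2:
  fixes P :: "(real \<times> real) set" and n :: nat
  assumes "finite P" and "card P = n"
  shows "finite (stable_lines_determined_by P)
    \<and> finite (stable_intersections (dual_arrangement P))
    \<and> card (stable_lines_determined_by P) = card (stable_intersections (dual_arrangement P))"
proof -
  let ?I = "stable_intersections (dual_arrangement P)"
  let ?line = "\<lambda>x. tropical_line (- x)"
  have "?I \<subseteq> (\<lambda>(p, q). tropical_cross (- p) (- q)) ` (P \<times> P)"
    unfolding stable_intersections_dual_arrangement by force
  then have fin: "finite ?I"
    using assms(1) finite_subset by blast
  have "stable_lines_determined_by P = ?line ` ?I"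
  proof
    show "?line ` ?I \<subseteq> stable_lines_determined_by P"
      using stable_line_of_cross[OF assms(1)] by (auto simp: stable_intersections_dual_arrangement)
    show "stable_lines_determined_by P \<subseteq> ?line ` ?I"
    proof
      fix L assume L: "L \<in> stable_lines_determined_by P"
      then obtain v where v: "L = tropical_line v"
        by (auto simp: stable_lines_determined_by_def stable_tropical_line_def is_tropical_line_def)
      then obtain p q where "p \<in> P" "q \<in> P" "p \<noteq> q" "v = - tropical_cross (- p) (- q)"
        using cross_of_stable_line L by blast
      then show "L \<in> ?line ` ?I"
        unfolding v stable_intersections_dual_arrangement by blast
    qed
  qed
  moreover have "inj_on ?line ?I"
    by (simp add: inj_on_def)
  ultimately show ?thesis
    using fin by (simp add: card_image)
qed

end
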